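(* Let $A\in\mathbb{R}^{n\times n}$, let $S=(A+A^\top)/2$, $c=\operatorname{tr}A/n$ and $R_A=A^2+2AA^\top+(A^\top)^2$. As $T\to0^+$, $$\gamma_{\mathrm{rel}}(A,T)=\frac{T}{n}+\frac{\operatorname{tr}A}{n^2}T^2+\left(\frac{(\operatorname{tr}A)^2}{n^3}-\frac{\operatorname{tr}R_A}{12n^2}\right)T^3+\mathrm{O}(T^4).$$ For every sufficiently small $T>0$ the relaxed maximizer $X_T$ (the maximizer in the definition of $\gamma_{\mathrm{rel}}(A,T)$) is unique; it depends analytically on $T$ near zero, and satisfies, as $T\to0^+$, $$X_T=\frac1n\bigg(\mathrm{Id}+T(c\,\mathrm{Id}-S)+T^2\Big(\Big(c^2-\frac{\operatorname{tr}R_A}{12n}\Big)\mathrm{Id}-cS+\frac1{12}R_A\Big)\bigg)+\mathrm{O}(T^3).$$ In particular, $r(A,T)=n$ for every sufficiently small $T>0$.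
   Context: For $A\in\mathbb{R}^{n\times n}$, $T>0$ and a real symmetric $n\times n$ matrix $X$, set $\mathcal{G}_T(X)=\int_0^Te^{tA}Xe^{tA^\top}\,dt$. A covariance is a real symmetric matrix $X\succeq0$ with $\operatorname{tr}X=1$. The relaxed value is $$\gamma_{\mathrm{rel}}(A,T)=\max_{X\succeq0,\ \operatorname{tr}X=1}\lambda_{\min}(\mathcal{G}_T(X)),$$ and a relaxed maximizer is a covariance attaining this maximum. The recovery rank is $r(A,T)=\min\{\operatorname{rank}X\mid X\succeq0,\ \operatorname{tr}X=1,\ \lambda_{\min}(\mathcal{G}_T(X))=\gamma_{\mathrm{rel}}(A,T)\}$. *)

theory Defs
  imports "HOL-Analysis.Analysis" "HOL-Library.Landau_Symbols"
begin

(* Multiplication and powers on the vector type real^'n^'n are componentwise, so the library's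
   overloaded (^) and exp are not the matrix power and exponential. *)

definition matrix_pow :: "real^'n^'n \<Rightarrow> nat \<Rightarrow> real^'n^'n" where
  "matrix_pow A k = ((\<lambda>B. A ** B) ^^ k) (mat 1)"

definition matrix_exp :: "real^'n^'n \<Rightarrow> real^'n^'n" where
  "matrix_exp A = (\<Sum>k. (1 / fact k) *\<^sub>R matrix_pow A k)"

definition gramian :: "real^'n^'n \<Rightarrow> real \<Rightarrow> real^'n^'n \<Rightarrow> real^'n^'n" where
  "gramian A T X =
     integral {0..T} (\<lambda>t. matrix_exp (t *\<^sub>R A) ** X ** matrix_exp (t *\<^sub>R transpose A))"

definition positive_semidefinite :: "real^'n^'n \<Rightarrow> bool" where
  "positive_semidefinite X \<longleftrightarrow> transpose X = X \<and> (\<forall>v. 0 \<le> v \<bullet> (X *v v))"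

definition covariance_matrix :: "real^'n^'n \<Rightarrow> bool" where
  "covariance_matrix X \<longleftrightarrow> positive_semidefinite X \<and> trace X = 1"

(* Only meaningful for symmetric matrices, whose set of real eigenvalues is finite and nonempty. *)
definition lambda_min :: "real^'n^'n \<Rightarrow> real" where
  "lambda_min M = Min {l. \<exists>v. v \<noteq> 0 \<and> M *v v = l *\<^sub>R v}"

(* The maximum is attained for every T > 0: lambda_min is continuous on symmetric matrices and the
   covariances form a compact set. *)
definition gamma_rel :: "real^'n^'n \<Rightarrow> real \<Rightarrow> real" where
  "gamma_rel A T = (GREATEST g. \<exists>X. covariance_matrix X \<and> g = lambda_min (gramian A T X))"

definition relaxed_maximizer :: "real^'n^'n \<Rightarrow> real \<Rightarrow> real^'n^'n \<Rightarrow> bool" where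
  "relaxed_maximizer A T X \<longleftrightarrow>
     covariance_matrix X \<and> lambda_min (gramian A T X) = gamma_rel A T"

definition recovery_rank :: "real^'n^'n \<Rightarrow> real \<Rightarrow> nat" where
  "recovery_rank A T = (LEAST r. \<exists>X. relaxed_maximizer A T X \<and> r = rank X)"

(* Real analyticity of a curve: the library's analytic_on is for complex functions only. *)
definition real_analytic_on :: "(real \<Rightarrow> 'a::real_normed_vector) \<Rightarrow> real set \<Rightarrow> bool" where
  "real_analytic_on f S \<longleftrightarrow>
     (\<forall>x\<in>S. \<exists>r>0. \<exists>c. \<forall>y. \<bar>y - x\<bar> < r \<longrightarrow> (\<lambda>k. (y - x) ^ k *\<^sub>R c k) sums f y)"

end

theory Submission
  imports Defs "HOL-Complex_Analysis.Cauchy_Integral_Formula"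
begin

text \<open>With \<open>L X = A ** X + X ** transpose A\<close> one has \<open>gramian A T = T * \<phi> (T * L)\<close> for
  \<open>\<phi> z = (exp z - 1) / z\<close>, so for small \<open>T\<close> the operator \<open>J = \<psi> (T * L)\<close> with the reciprocal power series
  \<open>\<psi> = 1 - z / 2 + z\<^sup>2 / 12 - \<dots>\<close> inverts it up to the factor \<open>T\<close>.  Then \<open>P = J (mat 1)\<close> is close to the
  identity, \<open>P / trace P\<close> is a covariance and its Gramian is \<open>T / trace P\<close> times the identity.  It is the
  only maximizer: \<open>J\<close> is so close to the identity that \<open>trace (J N) \<ge> trace N / 2\<close> for \<open>N \<succeq> 0\<close>, and this
  applies to the excess of the Gramian of any covariance over its smallest eigenvalue.  The expansions and the
  analyticity are read off from the power series of \<open>P\<close>.\<close>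

subsection \<open>Power series of a bounded operator\<close>

text \<open>The product bound makes the family absolutely summable on pairs of indices, so summation
  by rows and by antidiagonals gives the same value. Since \<open>u\<close> is an arbitrary family
  in a Banach space, the lemma covers compositions of operator series as well as products of matrix
  series.\<close>

lemma suminf_suminf_diagonal:
  fixes u :: "nat \<Rightarrow> nat \<Rightarrow> 'a::banach"
  assumes f: "summable f" and g: "summable g"
    and u: "\<And>i j. norm (u i j) \<le> f i * g j"
    and f0: "\<And>i. 0 \<le> f i" and g0: "\<And>j. 0 \<le> g j"
  shows "(\<Sum>i. \<Sum>j. u i j) = (\<Sum>k. \<Sum>i\<le>k. u i (k - i))"
proof -
  let ?u = "\<lambda>(i, j). u i j"
  have has: "(h has_sum suminf h) UNIV" if "summable (\<lambda>n. norm (h n))" for h :: "nat \<Rightarrow> 'b::banach"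
    using that norm_summable_imp_has_sum summable_norm_cancel summable_sums by blast
  have "((\<lambda>j. f i * g j) has_sum (f i * suminf g)) UNIV" for i
    using g g0 by (intro has_sum_cmult_right) (simp add: has)
  moreover have "((\<lambda>i. f i * suminf g) has_sum (suminf f * suminf g)) UNIV"
    using f f0 by (intro has_sum_cmult_left) (simp add: has)
  ultimately have "(\<lambda>(i, j). f i * g j) summable_on (UNIV \<times> UNIV)"
    by (intro summable_on_SigmaI[where g = "\<lambda>i. f i * suminf g"]) (auto simp: summable_on_def f0 g0)
  then have abs: "?u abs_summable_on UNIV"
    using u by (intro Infinite_Sum.abs_summable_on_comparison_test'[where g = "\<lambda>(i, j). f i * g j"])
      (auto simp: case_prod_beta)
  then have su: "?u summable_on (UNIV \<times> UNIV)"
    by (simp add: abs_summable_summable)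
  have row: "(u i has_sum (\<Sum>j. u i j)) UNIV" for i
  proof -
    have "summable (\<lambda>j. norm (u i j))"
      by (rule summable_comparison_test'[where g = "\<lambda>j. f i * g j"])
        (use g u in \<open>auto intro: summable_mult\<close>)
    then show ?thesis by (rule has)
  qed
  have "((\<lambda>i. \<Sum>j. u i j) has_sum infsum ?u (UNIV \<times> UNIV)) UNIV"
    by (rule has_sum_SigmaD[OF has_sum_infsum[OF su]]) (simp add: row)
  then have 1: "(\<Sum>i. \<Sum>j. u i j) = infsum ?u UNIV"
    by (simp add: has_sum_imp_sums sums_unique[symmetric])
  have bij: "bij_betw (\<lambda>(k, i). (i, k - i)) (SIGMA k:UNIV. {..k}) (UNIV :: (nat \<times> nat) set)"
    by (rule bij_betwI[where g = "\<lambda>(i, j). (i + j, i)"]) auto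
  have sd: "(\<lambda>(k, i). u i (k - i)) summable_on (SIGMA k:UNIV. {..k})"
    using summable_on_reindex_bij_betw[OF bij, of ?u] su
    by (simp add: case_prod_unfold)
  have id: "infsum (\<lambda>(k, i). u i (k - i)) (SIGMA k:UNIV. {..k}) = infsum ?u UNIV"
    using infsum_reindex_bij_betw[OF bij, of ?u] by (simp add: case_prod_unfold)
  have "((\<lambda>k. \<Sum>i\<le>k. u i (k - i)) has_sum infsum (\<lambda>(k, i). u i (k - i)) (SIGMA k:UNIV. {..k})) UNIV"
    using has_sum_SigmaD[OF has_sum_infsum[OF sd], of "\<lambda>k. \<Sum>i\<le>k. u i (k - i)"]
    by (simp add: has_sum_finite)
  then show ?thesis
    using has_sum_imp_sums sums_unique by (simp add: 1 id) blast
qed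

definition op_series :: "(nat \<Rightarrow> real) \<Rightarrow> ('a::real_normed_vector \<Rightarrow> 'a) \<Rightarrow> real \<Rightarrow> 'a \<Rightarrow> 'a" where
  "op_series a L t x = (\<Sum>k. (a k * t ^ k) *\<^sub>R (L ^^ k) x)"

text \<open>The bound \<open>K\<close> is explicit and positive: for coefficients of modulus at most
  1, all series below converge for \<open>\<bar>t\<bar> * K < 1\<close>, that is, on the disc of
  radius \<open>1 / K\<close>.\<close>

locale bounded_operator =
  fixes L :: "'a::banach \<Rightarrow> 'a" and K :: real
  assumes bl: "bounded_linear L"
    and norm_le: "\<And>x. norm (L x) \<le> K * norm x"
    and K_pos: "0 < K"
begin

lemma bl_funpow: "bounded_linear (L ^^ k)"
  by (induction k) (simp_all add: bounded_linear_ident id_def bounded_linear_compose[OF bl, unfolded o_def] o_def)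

lemma norm_funpow_le: "norm ((L ^^ k) x) \<le> K ^ k * norm x"
proof (induction k)
  case (Suc k)
  have "norm (L ((L ^^ k) x)) \<le> K * norm ((L ^^ k) x)" by (rule norm_le)
  also have "\<dots> \<le> K * (K ^ k * norm x)" using Suc K_pos by (simp add: mult_left_mono)
  finally show ?case by (simp add: mult.assoc)
qed simp

lemma norm_term_le:
  assumes "\<bar>c\<bar> \<le> 1"
  shows "norm ((c * t ^ k) *\<^sub>R (L ^^ k) x) \<le> (\<bar>t\<bar> * K) ^ k * norm x"
proof -
  have "norm ((c * t ^ k) *\<^sub>R (L ^^ k) x) = \<bar>c\<bar> * (\<bar>t\<bar> ^ k * norm ((L ^^ k) x))"
    by (simp add: abs_mult power_abs)
  also have "\<dots> \<le> 1 * (\<bar>t\<bar> ^ k * (K ^ k * norm x))"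
    using assms norm_funpow_le by (intro mult_mono) auto
  finally show ?thesis by (simp add: power_mult_distrib mult.assoc)
qed

lemma summable_geom:
  assumes "\<bar>t\<bar> * K < 1"
  shows "summable (\<lambda>k. (\<bar>t\<bar> * K) ^ k * c)"
  using assms K_pos by (intro summable_mult2 summable_geometric) (simp add: abs_mult)

context
  fixes a :: "nat \<Rightarrow> real" and t :: real
  assumes a: "\<And>k. \<bar>a k\<bar> \<le> 1" and t: "\<bar>t\<bar> * K < 1"
begin

lemma summable_norm_op_series: "summable (\<lambda>k. norm ((a k * t ^ k) *\<^sub>R (L ^^ k) x))"
  by (rule summable_comparison_test'[OF summable_geom[OF t, of "norm x"], of 0]) (use norm_term_le[OF a] in auto)

lemma op_series_sums: "(\<lambda>k. (a k * t ^ k) *\<^sub>R (L ^^ k) x) sums op_series a L t x"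
  unfolding op_series_def
  by (intro summable_sums summable_norm_cancel[OF summable_norm_op_series])

lemma op_series_split:
  "op_series a L t x = (\<Sum>i<m. (a i * t ^ i) *\<^sub>R (L ^^ i) x) + 
     (\<Sum>k. (a (k + m) * t ^ (k + m)) *\<^sub>R (L ^^ (k + m)) x)"
  unfolding op_series_def
  using suminf_split_initial_segment[OF sums_summable[OF op_series_sums], of x m] by simp

text \<open>The tail after \<open>m\<close> terms is dominated by a geometric series with ratio
  \<open>\<bar>t\<bar> * K\<close>. The case \<open>m = 1\<close> measures the distance to the
  identity, the case \<open>m = 3\<close> gives the expansion in \<open>t\<close>.\<close>

lemma op_series_remainder:
  "norm (op_series a L t x - (\<Sum>i<m. (a i * t ^ i) *\<^sub>R (L ^^ i) x))
     \<le> (\<bar>t\<bar> * K) ^ m / (1 - \<bar>t\<bar> * K) * norm x"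
proof -
  have "norm (\<Sum>k. (a (k + m) * t ^ (k + m)) *\<^sub>R (L ^^ (k + m)) x)
      \<le> (\<Sum>k. (\<bar>t\<bar> * K) ^ (k + m) * norm x)"
    by (rule norm_suminf_le[OF norm_term_le[OF a]])
      (rule summable_ignore_initial_segment[OF summable_geom[OF t]])
  also have "\<dots> = (\<Sum>k. (\<bar>t\<bar> * K) ^ k * ((\<bar>t\<bar> * K) ^ m * norm x))"
    by (simp only: power_add mult.assoc)
  also have "\<dots> = (\<bar>t\<bar> * K) ^ m / (1 - \<bar>t\<bar> * K) * norm x"
    using suminf_mult2[of "\<lambda>k. (\<bar>t\<bar> * K) ^ k" "(\<bar>t\<bar> * K) ^ m * norm x"] t K_pos
    by (simp add: suminf_geometric)
  finally show ?thesis by (subst op_series_split[of x m]) simp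
qed

lemma linear_op_series: "linear (op_series a L t)"
proof
  have lin: "linear (L ^^ k)" for k
    by (rule bounded_linear.linear[OF bl_funpow])
  show "op_series a L t (x + y) = op_series a L t x + op_series a L t y" for x y
  proof (rule sums_unique2[OF op_series_sums])
    show "(\<lambda>k. (a k * t ^ k) *\<^sub>R (L ^^ k) (x + y)) sums (op_series a L t x + op_series a L t y)"
      using sums_add[OF op_series_sums[of x] op_series_sums[of y]]
      by (simp add: linear_add[OF lin] scaleR_add_right)
  qed
  show "op_series a L t (r *\<^sub>R x) = r *\<^sub>R op_series a L t x" for r x
  proof (rule sums_unique2[OF op_series_sums])
    show "(\<lambda>k. (a k * t ^ k) *\<^sub>R (L ^^ k) (r *\<^sub>R x)) sums (r *\<^sub>R op_series a L t x)"
      using sums_scaleR_right[OF op_series_sums[of x], of r]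
      by (simp add: linear_scale[OF lin] mult.commute)
  qed
qed

end

text \<open>Composition of operator series corresponds to the Cauchy product of the coefficients,
  because the iterates of \<open>L\<close> add up along antidiagonals. The hypothesis
  \<open>inv\<close> says that the two power series are reciprocal, so only the term
  \<open>k = 0\<close> survives.\<close>

lemma op_series_comp:
  assumes a: "\<And>k. \<bar>a k\<bar> \<le> 1" and b: "\<And>k. \<bar>b k\<bar> \<le> 1" and t: "\<bar>t\<bar> * K < 1"
    and inv: "\<And>k. (\<Sum>i\<le>k. a i * b (k - i)) = (if k = 0 then 1 else 0)"
  shows "op_series a L t (op_series b L t x) = x"
proof -
  let ?q = "\<bar>t\<bar> * K"
  let ?u = "\<lambda>i j. (a i * t ^ i) *\<^sub>R (L ^^ i) ((b j * t ^ j) *\<^sub>R (L ^^ j) x)"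
  have nu: "norm (?u i j) \<le> ?q ^ i * (?q ^ j * norm x)" for i j
  proof -
    have "norm (?u i j) \<le> ?q ^ i * norm ((b j * t ^ j) *\<^sub>R (L ^^ j) x)"
      by (rule norm_term_le[OF a])
    also have "\<dots> \<le> ?q ^ i * (?q ^ j * norm x)"
      using norm_term_le[OF b] K_pos by (intro mult_left_mono) auto
    finally show ?thesis .
  qed
  have "(a i * t ^ i) *\<^sub>R (L ^^ i) (op_series b L t x) = (\<Sum>j. ?u i j)" for i
    unfolding op_series_def
    by (rule bounded_linear.suminf[OF bounded_linear_compose[OF bounded_linear_scaleR_right bl_funpow]])
      (rule sums_summable[OF op_series_sums[OF b t]])
  then have "op_series a L t (op_series b L t x) = (\<Sum>i. \<Sum>j. ?u i j)"
    by (simp add: op_series_def[of a])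
  also have "\<dots> = (\<Sum>k. \<Sum>i\<le>k. ?u i (k - i))"
    by (rule suminf_suminf_diagonal[OF _ summable_geom[OF t] nu])
      (use K_pos t in \<open>auto intro: summable_geometric simp: abs_mult\<close>)
  also have "\<dots> = (\<Sum>k. (if k = 0 then x else 0))"
  proof (rule suminf_cong)
    fix k
    have "?u i (k - i) = (a i * b (k - i)) *\<^sub>R (t ^ k *\<^sub>R (L ^^ k) x)" if "i \<le> k" for i
    proof -
      have "(L ^^ i) ((L ^^ (k - i)) x) = (L ^^ k) x"
        using that by (metis comp_apply funpow_add le_add_diff_inverse)
      then show ?thesis using that
        by (simp add: bounded_linear.linear[OF bl_funpow, THEN linear_scale] mult_ac flip: power_add)
    qed
    then have "(\<Sum>i\<le>k. ?u i (k - i)) = (\<Sum>i\<le>k. a i * b (k - i)) *\<^sub>R (t ^ k *\<^sub>R (L ^^ k) x)"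
      by (simp only: scaleR_sum_left) simp
    then show "(\<Sum>i\<le>k. ?u i (k - i)) = (if k = 0 then x else 0)"
      by (simp add: inv)
  qed
  also have "\<dots> = x"
    using suminf_finite[of "{0}" "\<lambda>k. if k = (0::nat) then x else 0"] by simp
  finally show ?thesis .
qed

end

section \<open>The Taylor coefficients B_k / k! of z / (exp z - 1), with B_k the Bernoulli
  numbers\<close>

definition inv_coeff :: "nat \<Rightarrow> real" where
  "inv_coeff k = fps_nth (inverse (Abs_fps (\<lambda>k. 1 / fact (Suc k)))) k"

lemma inv_coeff_convolution:
  "(\<Sum>i\<le>k. 1 / fact (Suc i) * inv_coeff (k - i)) = (if k = 0 then 1 else 0)"
proof -
  let ?f = "Abs_fps (\<lambda>k. 1 / fact (Suc k) :: real)"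
  have "?f * inverse ?f = 1"
    by (rule inverse_mult_eq_1') simp
  then have "fps_nth (?f * inverse ?f) k = (if k = 0 then 1 else 0)"
    by simp
  then show ?thesis
    by (simp add: fps_mult_nth inv_coeff_def atLeast0AtMost)
qed

lemma inv_coeff_convolution':
  "(\<Sum>i\<le>k. inv_coeff i * (1 / fact (Suc (k - i)))) = (if k = 0 then 1 else 0)"
proof -
  have "(\<Sum>i\<le>k. inv_coeff i * (1 / fact (Suc (k - i)))) = (\<Sum>i\<le>k. 1 / fact (Suc i) * inv_coeff (k - i))"
    by (rule sum.reindex_bij_witness[of _ "\<lambda>i. k - i" "\<lambda>i. k - i"]) auto
  then show ?thesis by (simp only: inv_coeff_convolution)
qed

lemma inv_coeff_simps: "inv_coeff 0 = 1" "inv_coeff 1 = - 1 / 2" "inv_coeff 2 = 1 / 12"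
  using inv_coeff_convolution[of 0] inv_coeff_convolution[of 1] inv_coeff_convolution[of 2]
  by (simp_all add: numeral_2_eq_2)

lemma two_power_le_fact_Suc: "2 ^ k \<le> (fact (Suc k) :: real)"
proof (induction k)
  case (Suc k)
  have "2 * 2 ^ k \<le> real (Suc (Suc k)) * (fact (Suc k) :: real)"
    using Suc by (intro mult_mono) auto
  then show ?case by simp
qed simp

text \<open>Strong induction: the convolution identity writes each coefficient as minus a
  combination of earlier ones, with weights \<open>1 / fact (i + 2)\<close> at most
  \<open>(1 / 2) ^ (i + 1)\<close>, whose sum is at most 1.\<close>

lemma abs_inv_coeff_le: "\<bar>inv_coeff k\<bar> \<le> 1"
proof (induction k rule: less_induct)
  case (less k)
  show ?case
  proof (cases k)
    case 0
    then show ?thesis by (simp add: inv_coeff_simps)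
  next
    case (Suc m)
    have geo: "(\<Sum>i\<le>m. (1 / 2) ^ Suc i :: real) \<le> 1" for m
    proof -
      have "(\<Sum>i\<le>m. (1 / 2) ^ Suc i :: real) = 1 - (1 / 2) ^ Suc m"
        by (induction m) (auto simp: field_simps)
      then show ?thesis by simp
    qed
    \<comment> \<open>The term \<open>i = 0\<close> of the convolution has weight 1 and is split
      off; the remaining indices are shifted by one.\<close>
    have *: "0 = inv_coeff (Suc m) + (\<Sum>i\<le>m. 1 / fact (Suc (Suc i)) * inv_coeff (m - i))"
      using inv_coeff_convolution[of "Suc m"] by (subst (asm) sum.atMost_Suc_shift) simp
    have "\<bar>inv_coeff k\<bar> = \<bar>\<Sum>i\<le>m. 1 / fact (Suc (Suc i)) * inv_coeff (m - i)\<bar>"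
      unfolding Suc using * by (simp only: eq_neg_iff_add_eq_0[symmetric] abs_minus_cancel)
    also have "\<dots> \<le> (\<Sum>i\<le>m. (1 / 2) ^ Suc i)"
    proof (rule order.trans[OF sum_abs sum_mono])
      fix i assume "i \<in> {..m}"
      have "\<bar>1 / fact (Suc (Suc i)) * inv_coeff (m - i)\<bar> = 1 / fact (Suc (Suc i)) * \<bar>inv_coeff (m - i)\<bar>"
        by (simp only: abs_mult) simp
      also have "\<dots> \<le> (1 / 2 ^ Suc i) * 1"
      proof (rule mult_mono)
        show "1 / fact (Suc (Suc i)) \<le> (1 / 2 ^ Suc i :: real)"
          using two_power_le_fact_Suc[of "Suc i"] by (intro divide_left_mono) auto
        show "\<bar>inv_coeff (m - i)\<bar> \<le> 1"
          using Suc by (intro less) auto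
      qed auto
      finally show "\<bar>1 / fact (Suc (Suc i)) * inv_coeff (m - i)\<bar> \<le> (1 / 2) ^ Suc i"
        by (simp add: power_one_over)
    qed
    finally show ?thesis using geo[of m] by linarith
  qed
qed

text \<open>In each coordinate the integrand is a real power series of radius at least
  \<open>1 / K\<close>. Its antiderivative, found by termwise integration, is \<open>t\<close> times
  the series with coefficients \<open>1 / fact (Suc k)\<close>, and the fundamental theorem of
  calculus applies.\<close>

lemma has_integral_op_series:
  fixes L :: "'a::euclidean_space \<Rightarrow> 'a"
  assumes "bounded_operator L K" and T: "0 \<le> T" "T * K < 1"
  shows "((\<lambda>t. op_series (\<lambda>k. 1 / fact k) L t x) has_integral
          T *\<^sub>R op_series (\<lambda>k. 1 / fact (Suc k)) L T x) {0..T}"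
proof -
  interpret bounded_operator L K by fact
  show ?thesis
  proof (subst has_integral_componentwise_iff, intro ballI)
    fix b :: 'a assume "b \<in> Basis"
    \<comment> \<open>Coefficients of the antiderivative: the index is shifted by one because of the
      factor \<open>t\<close>, and the constant term 0 makes it vanish at the lower limit.\<close>
    define c where "c n = (case n of 0 \<Rightarrow> 0 | Suc k \<Rightarrow> ((L ^^ k) x \<bullet> b) / fact (Suc k))" for n :: nat
    have small: "\<bar>t\<bar> * K < 1" if "\<bar>t\<bar> < 1 / K" for t
      using that K_pos by (simp add: field_simps)
    have F: "(\<lambda>n. c n * t ^ n) sums (t * (op_series (\<lambda>k. 1 / fact (Suc k)) L t x \<bullet> b))"
      if "\<bar>t\<bar> < 1 / K" for t
    proof -
      have "(\<lambda>k. ((1 / fact (Suc k) * t ^ k) *\<^sub>R (L ^^ k) x) \<bullet> b) sums (op_series (\<lambda>k. 1 / fact (Suc k)) L t x \<bullet> b)"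
        by (rule bounded_linear.sums[OF bounded_linear_inner_left op_series_sums[OF _ small[OF that]]])
          (simp add: fact_ge_1 del: fact_Suc)
      then have "(\<lambda>k. t * (((1 / fact (Suc k) * t ^ k) *\<^sub>R (L ^^ k) x) \<bullet> b)) sums (t * (op_series (\<lambda>k. 1 / fact (Suc k)) L t x \<bullet> b))"
        by (rule sums_mult)
      then have "(\<lambda>k. c (Suc k) * t ^ Suc k) sums (t * (op_series (\<lambda>k. 1 / fact (Suc k)) L t x \<bullet> b))"
        by (simp add: c_def mult_ac del: fact_Suc)
      then show ?thesis
        by (subst (asm) sums_Suc_iff) (simp add: c_def)
    qed
    have D: "(\<Sum>n. diffs c n * t ^ n) = op_series (\<lambda>k. 1 / fact k) L t x \<bullet> b"
      if "\<bar>t\<bar> < 1 / K" for t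
    proof -
      have "(\<lambda>k. ((1 / fact k * t ^ k) *\<^sub>R (L ^^ k) x) \<bullet> b) sums (op_series (\<lambda>k. 1 / fact k) L t x \<bullet> b)"
        by (rule bounded_linear.sums[OF bounded_linear_inner_left op_series_sums[OF _ small[OF that]]])
          (simp add: fact_ge_1)
      moreover have "diffs c k * t ^ k = ((1 / fact k * t ^ k) *\<^sub>R (L ^^ k) x) \<bullet> b" for k
        by (simp add: diffs_def c_def fact_Suc[of k] field_simps del: of_nat_Suc)
      ultimately show ?thesis by (simp add: sums_iff)
    qed
    have der: "((\<lambda>t. \<Sum>n. c n * t ^ n) has_field_derivative (op_series (\<lambda>k. 1 / fact k) L t x \<bullet> b)) (at t)"
      if "\<bar>t\<bar> < 1 / K" for t
      using termdiffs_strong'[of "1 / K" c t] that F by (auto simp: D dest: sums_summable)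
    have le: "\<bar>t\<bar> < 1 / K" if "t \<in> {0..T}" for t
    proof -
      have "t * K \<le> T * K" using that K_pos by (intro mult_right_mono) auto
      then have "\<bar>t\<bar> * K < 1" using that T by simp
      then show ?thesis using K_pos by (simp add: pos_less_divide_eq)
    qed
    have "((\<lambda>t. op_series (\<lambda>k. 1 / fact k) L t x \<bullet> b) has_integral
            (\<Sum>n. c n * T ^ n) - (\<Sum>n. c n * 0 ^ n)) {0..T}"
      by (rule fundamental_theorem_of_calculus[OF T(1)])
        (use der le in \<open>auto simp flip: has_real_derivative_iff_has_vector_derivative
          intro: has_field_derivative_at_within\<close>)
    moreover have "(\<Sum>n. c n * T ^ n) = T * (op_series (\<lambda>k. 1 / fact (Suc k)) L T x \<bullet> b)"
      using F[OF le[of T]] T(1) by (simp add: sums_iff)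
    moreover have "(\<Sum>n. c n * 0 ^ n) = 0"
      by (simp only: powser_zero) (simp add: c_def)
    ultimately show "((\<lambda>t. op_series (\<lambda>k. 1 / fact k) L t x \<bullet> b) has_integral
        (T *\<^sub>R op_series (\<lambda>k. 1 / fact (Suc k)) L T x) \<bullet> b) {0..T}"
      by simp
  qed
qed

subsection \<open>The Gramian and the Lyapunov operator\<close>

lemma bounded_bilinear_matrix_mult:
  "bounded_bilinear ((**) :: real^'n^'m \<Rightarrow> real^'p^'n \<Rightarrow> real^'p^'m)"
proof -
  have "bilinear ((**) :: real^'n^'m \<Rightarrow> real^'p^'n \<Rightarrow> real^'p^'m)"
    unfolding bilinear_def
    by (auto intro!: linearI simp: vec_eq_iff matrix_matrix_mult_def sum_distrib_left sum.distrib algebra_simps)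
  then show ?thesis by (simp add: bilinear_conv_bounded_bilinear)
qed

interpretation mm: bounded_bilinear "(**) :: real^'n^'n \<Rightarrow> real^'n^'n \<Rightarrow> real^'n^'n"
  by (rule bounded_bilinear_matrix_mult)

lemma matrix_pow_0 [simp]: "matrix_pow A 0 = mat 1"
  by (simp add: matrix_pow_def)

lemma matrix_pow_Suc: "matrix_pow A (Suc k) = A ** matrix_pow A k"
  by (simp add: matrix_pow_def)

lemma matrix_pow_Suc2: "matrix_pow A (Suc k) = matrix_pow A k ** A"
  by (induction k) (simp_all add: matrix_pow_Suc matrix_mul_assoc)

lemma matrix_mult_bound: "\<exists>K\<ge>0. \<forall>(A :: real^'n^'n) (B :: real^'n^'n). norm (A ** B) \<le> norm A * norm B * K"
  by (rule mm.nonneg_bounded)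

lemma summable_norm_matrix_exp:
  fixes A :: "real^'n^'n"
  shows "summable (\<lambda>k. norm ((1 / fact k) *\<^sub>R matrix_pow A k))"
proof -
  obtain K where K: "\<And>(A :: real^'n^'n) (B :: real^'n^'n). norm (A ** B) \<le> norm A * norm B * K" "0 \<le> K"
    using matrix_mult_bound[where 'n = 'n] by blast
  define c where "c = norm A * K"
  have *: "norm (matrix_pow A k) \<le> c ^ k * norm (mat 1 :: real^'n^'n)" for k
  proof (induction k)
    case (Suc k)
    have "norm (matrix_pow A (Suc k)) \<le> c * norm (matrix_pow A k)"
      using K(1)[of A "matrix_pow A k"] by (simp add: matrix_pow_Suc c_def mult_ac)
    also have "\<dots> \<le> c * (c ^ k * norm (mat 1 :: real^'n^'n))"
      using Suc K(2) by (intro mult_left_mono) (auto simp: c_def)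
    finally show ?case by (simp add: mult.assoc)
  qed simp
  have "summable (\<lambda>k. inverse (fact k) * c ^ k * norm (mat 1 :: real^'n^'n))"
    by (intro summable_mult2 summable_exp)
  then show ?thesis
    by (rule summable_comparison_test'[where N = 0])
      (use * in \<open>auto simp: divide_simps mult_ac\<close>)
qed

lemma matrix_exp_sums: "(\<lambda>k. (1 / fact k) *\<^sub>R matrix_pow A k) sums matrix_exp A"
  unfolding matrix_exp_def
  by (intro summable_sums summable_norm_cancel[OF summable_norm_matrix_exp])

text \<open>The binomial theorem for left multiplication by \<open>A\<close> and right
  multiplication by \<open>B\<close>, which commute with each other. Division by the factorials
  turns the binomial sum into a convolution.\<close>

lemma sylvester_power:
  fixes A B X :: "real^'n^'n"
  shows "(1 / fact k) *\<^sub>R ((\<lambda>Y. A ** Y + Y ** B) ^^ k) X =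
    (\<Sum>i\<le>k. ((1 / fact i) *\<^sub>R matrix_pow A i) ** X ** ((1 / fact (k - i)) *\<^sub>R matrix_pow B (k - i)))"
proof (induction k)
  case 0
  then show ?case by simp
next
  case (Suc k)
  define h where "h i j = ((1 / fact i) *\<^sub>R matrix_pow A i) ** X ** ((1 / fact j) *\<^sub>R matrix_pow B j)" for i j
  have h1: "A ** h i j = real (Suc i) *\<^sub>R h (Suc i) j" for i j
    by (simp add: h_def mm.scaleR_left mm.scaleR_right matrix_pow_Suc matrix_mul_assoc)
  have h2: "h i j ** B = real (Suc j) *\<^sub>R h i (Suc j)" for i j
    by (simp add: h_def mm.scaleR_left mm.scaleR_right matrix_pow_Suc2 matrix_mul_assoc)
  have "(1 / fact k) *\<^sub>R ((\<lambda>Y. A ** Y + Y ** B) ^^ Suc k) X =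
     A ** ((1 / fact k) *\<^sub>R ((\<lambda>Y. A ** Y + Y ** B) ^^ k) X) + ((1 / fact k) *\<^sub>R ((\<lambda>Y. A ** Y + Y ** B) ^^ k) X) ** B"
    by (simp add: mm.scaleR_left mm.scaleR_right scaleR_add_right)
  also have "\<dots> = (\<Sum>i\<le>k. real (Suc i) *\<^sub>R h (Suc i) (k - i)) + (\<Sum>i\<le>k. real (Suc (k - i)) *\<^sub>R h i (Suc (k - i)))"
    unfolding Suc by (simp only: h_def[symmetric] mm.sum_left mm.sum_right h1 h2)
  \<comment> \<open>Both sums are extended to \<open>i \<le> Suc k\<close> by a term of weight zero,
    at \<open>i = 0\<close> here and at \<open>i = Suc k\<close> in the next step. The weights
    \<open>i\<close> and \<open>Suc k - i\<close> then add up to \<open>Suc k\<close>.\<close>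
  also have "(\<Sum>i\<le>k. real (Suc i) *\<^sub>R h (Suc i) (k - i)) = (\<Sum>i\<le>Suc k. real i *\<^sub>R h i (Suc k - i))"
    by (simp only: sum.atMost_Suc_shift) simp
  also have "(\<Sum>i\<le>k. real (Suc (k - i)) *\<^sub>R h i (Suc (k - i))) = (\<Sum>i\<le>Suc k. real (Suc k - i) *\<^sub>R h i (Suc k - i))"
    by (simp add: Suc_diff_le of_nat_diff add_diff_eq)
  also have "(\<Sum>i\<le>Suc k. real i *\<^sub>R h i (Suc k - i)) + \<dots> = real (Suc k) *\<^sub>R (\<Sum>i\<le>Suc k. h i (Suc k - i))"
    by (simp only: sum.distrib[symmetric] scaleR_sum_right scaleR_add_left[symmetric])
      (rule sum.cong, auto simp: of_nat_diff add_diff_eq)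
  finally have "(1 / real (Suc k)) *\<^sub>R ((1 / fact k) *\<^sub>R ((\<lambda>Y. A ** Y + Y ** B) ^^ Suc k) X) = (\<Sum>i\<le>Suc k. h i (Suc k - i))"
    by (simp del: sum.atMost_Suc of_nat_Suc funpow.simps)
  then show ?case by (simp only: h_def) (simp del: sum.atMost_Suc funpow.simps)
qed

text \<open>Expanding both exponentials gives a double series; summed along antidiagonals it becomes
  the exponential series of the operator that sends \<open>Y\<close> to
  \<open>A ** Y + Y ** B\<close>.\<close>

lemma matrix_exp_sandwich:
  fixes A B X :: "real^'n^'n"
  shows "matrix_exp A ** X ** matrix_exp B = (\<Sum>k. (1 / fact k) *\<^sub>R ((\<lambda>Y. A ** Y + Y ** B) ^^ k) X)"
proof -
  obtain K where K: "\<And>(A :: real^'n^'n) (B :: real^'n^'n). norm (A ** B) \<le> norm A * norm B * K" "0 \<le> K"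
    using matrix_mult_bound[where 'n = 'n] by blast
  let ?a = "\<lambda>i. (1 / fact i) *\<^sub>R matrix_pow A i" and ?b = "\<lambda>j. (1 / fact j) *\<^sub>R matrix_pow B j"
  have "matrix_exp A ** X ** matrix_exp B = (\<Sum>i. (?a i ** X) ** matrix_exp B)"
    by (intro sums_unique mm.bounded_linear_left[THEN bounded_linear.sums] matrix_exp_sums)
  also have "\<dots> = (\<Sum>i. \<Sum>j. ?a i ** X ** ?b j)"
    by (intro suminf_cong sums_unique mm.bounded_linear_right[THEN bounded_linear.sums] matrix_exp_sums)
  also have "\<dots> = (\<Sum>k. \<Sum>i\<le>k. ?a i ** X ** ?b (k - i))"
  proof (rule suminf_suminf_diagonal[OF summable_norm_matrix_exp[of A] summable_mult2[OF summable_norm_matrix_exp[of B], of "norm X * K * K"]])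
    fix i j
    have "norm (?a i ** X ** ?b j) \<le> norm (?a i ** X) * norm (?b j) * K" by (rule K)
    also have "\<dots> \<le> (norm (?a i) * norm X * K) * norm (?b j) * K"
      using K(1)[of "?a i" X] K(2) by (intro mult_right_mono) (auto simp only: norm_ge_zero)
    finally show "norm (?a i ** X ** ?b j) \<le> norm (?a i) * (norm (?b j) * (norm X * K * K))"
      by (simp add: mult_ac)
  qed (use K in auto)
  finally show ?thesis by (simp only: sylvester_power)
qed

section \<open>The Lyapunov operator as generator of the Gramian integrand\<close>

definition lyapunov :: "real^'n^'n \<Rightarrow> real^'n^'n \<Rightarrow> real^'n^'n" where
  "lyapunov A X = A ** X + X ** transpose A"

lemma bounded_operator_lyapunov: "\<exists>K. bounded_operator (lyapunov A) K"
proof -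
  have "bounded_linear (lyapunov A)"
    unfolding lyapunov_def
    by (intro bounded_linear_add mm.bounded_linear_left mm.bounded_linear_right)
  then show ?thesis
    using bounded_linear.pos_bounded[of "lyapunov A"] by (auto simp: bounded_operator_def mult.commute)
qed

lemma matrix_exp_lyapunov:
  "matrix_exp (t *\<^sub>R A) ** X ** matrix_exp (t *\<^sub>R transpose A) = op_series (\<lambda>k. 1 / fact k) (lyapunov A) t X"
proof -
  have l: "linear (lyapunov A)"
    using bounded_operator_lyapunov[of A] by (auto simp: bounded_operator_def bounded_linear.linear)
  have "((\<lambda>Y. (t *\<^sub>R A) ** Y + Y ** (t *\<^sub>R transpose A)) ^^ k) X = t ^ k *\<^sub>R (lyapunov A ^^ k) X" for k :: nat
  proof (induction k)
    case (Suc k)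
    have "(t *\<^sub>R A) ** Y + Y ** (t *\<^sub>R transpose A) = t *\<^sub>R lyapunov A Y" for Y
      by (simp add: lyapunov_def mm.scaleR_left mm.scaleR_right scaleR_add_right)
    with Suc show ?case by (simp add: linear_scale[OF l])
  qed simp
  then show ?thesis
    by (simp add: matrix_exp_sandwich op_series_def)
qed

lemma gramian_eq_op_series:
  assumes "bounded_operator (lyapunov A) K" "0 \<le> T" "T * K < 1"
  shows "gramian A T X = T *\<^sub>R op_series (\<lambda>k. 1 / fact (Suc k)) (lyapunov A) T X"
  unfolding gramian_def matrix_exp_lyapunov
  using has_integral_op_series[OF assms] by (rule integral_unique)

lemma transpose_lyapunov_funpow:
  "transpose X = X \<Longrightarrow> transpose ((lyapunov A ^^ k) X) = (lyapunov A ^^ k) X"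
  by (induction k)
    (simp_all add: lyapunov_def matrix_transpose_mul transpose_def vec_eq_iff matrix_matrix_mult_def add.commute mult.commute)

subsection \<open>Positive semidefinite matrices\<close>

lemma symmetric_matrix_inner:
  fixes M :: "real^'n^'n"
  assumes "transpose M = M"
  shows "(M *v x) \<bullet> y = x \<bullet> (M *v y)"
  by (metis assms dot_lmul_matrix vector_transpose_matrix)

text \<open>A zero of a nonnegative form is a minimum, so its gradient vanishes there. Concretely,
  if \<open>w = N *v u\<close> were nonzero, a short step from \<open>u\<close> in direction
  \<open>- w\<close> would make the form negative.\<close>

lemma psd_quadratic_form_zero:
  fixes N :: "real^'n^'n"
  assumes sym: "transpose N = N" and psd: "\<And>v. 0 \<le> v \<bullet> (N *v v)" and u: "u \<bullet> (N *v u) = 0"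
  shows "N *v u = 0"
proof (rule ccontr)
  define w where "w = N *v u"
  define b where "b = w \<bullet> (N *v w)"
  \<comment> \<open>The denominator \<open>b + 1\<close> is positive even for \<open>b = 0\<close>,
    and it gives \<open>s * b \<le> w \<bullet> w\<close>, which contradicts the bound
    \<open>2 * (w \<bullet> w) \<le> s * b\<close> below.\<close>
  define s where "s = (w \<bullet> w) / (b + 1)"
  assume "N *v u \<noteq> 0"
  then have w: "0 < w \<bullet> w" by (simp add: w_def)
  have b: "0 \<le> b" by (simp add: b_def psd)
  have s: "0 < s" using w b by (simp add: s_def)
  have "(u - s *\<^sub>R w) \<bullet> (N *v (u - s *\<^sub>R w)) = s * (s * b - 2 * (w \<bullet> w))"
    using u symmetric_matrix_inner[OF sym, of u w]
    by (simp add: matrix_vector_mult_diff_distrib matrix_vector_mult_scaleR inner_diff_left inner_diff_right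
        b_def w_def[symmetric] inner_commute algebra_simps)
  then have "2 * (w \<bullet> w) \<le> s * b"
    using psd[of "u - s *\<^sub>R w"] s by (simp add: zero_le_mult_iff)
  also have "s * b \<le> w \<bullet> w"
    using w b by (simp add: s_def field_simps)
  finally show False using w by simp
qed

text \<open>Eigenvectors chosen for distinct eigenvalues are orthogonal, hence independent, and
  there are only finitely many of them. Finiteness makes the \<open>Min\<close> in
  \<open>lambda_min\<close> meaningful.\<close>

lemma symmetric_eigenvalues_finite:
  fixes M :: "real^'n^'n"
  assumes sym: "transpose M = M"
  shows "finite {l. \<exists>v. v \<noteq> 0 \<and> M *v v = l *\<^sub>R v}" (is "finite ?E")
proof -
  obtain e where e: "\<And>l. l \<in> ?E \<Longrightarrow> e l \<noteq> 0 \<and> M *v e l = l *\<^sub>R e l"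
    using bchoice[of ?E "\<lambda>l v. v \<noteq> 0 \<and> M *v v = l *\<^sub>R v"] by auto
  have orth: "e l \<bullet> e m = 0" if "l \<in> ?E" "m \<in> ?E" "l \<noteq> m" for l m
  proof -
    have "l * (e l \<bullet> e m) = m * (e l \<bullet> e m)"
      using symmetric_matrix_inner[OF sym, of "e l" "e m"] e that by simp
    then show ?thesis using that by simp
  qed
  have "inj_on e ?E"
    using e orth by (metis (no_types, lifting) inj_onI inner_eq_zero_iff)
  moreover have "pairwise orthogonal (e ` ?E)"
    unfolding pairwise_def orthogonal_def using orth by blast
  then have "independent (e ` ?E)"
    using e by (intro pairwise_orthogonal_independent) force+
  then have "finite (e ` ?E)"
    by (rule independent_imp_finite)
  ultimately show ?thesis by (rule finite_imageD[rotated])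
qed

text \<open>The form attains its minimum \<open>m\<close> on the unit sphere at some
  \<open>u\<close>. The shifted matrix \<open>M - m *\<^sub>R mat 1\<close> has a nonnegative form
  that vanishes at \<open>u\<close>, so \<open>u\<close> is an eigenvector for \<open>m\<close>; no
  eigenvalue lies below \<open>m\<close>.\<close>

lemma lambda_min_rayleigh:
  fixes M :: "real^'n^'n"
  assumes sym: "transpose M = M"
  shows "lambda_min M * (v \<bullet> v) \<le> v \<bullet> (M *v v)"
proof -
  let ?E = "{l. \<exists>v. v \<noteq> 0 \<and> M *v v = l *\<^sub>R v}"
  let ?q = "\<lambda>v. v \<bullet> (M *v v)"
  have "continuous_on (sphere 0 1) ?q"
    by (intro continuous_intros linear_continuous_on matrix_vector_mul_bounded_linear)
  moreover have "sphere (0 :: real^'n) 1 \<noteq> {}" by simp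
  ultimately have "\<exists>u\<in>sphere 0 1. \<forall>v\<in>sphere 0 1. ?q u \<le> ?q v"
    by (intro continuous_attains_inf compact_sphere)
  then obtain u where u: "u \<in> sphere 0 1" and min: "\<And>v. v \<in> sphere 0 1 \<Longrightarrow> ?q u \<le> ?q v"
    by blast
  define m where "m = ?q u"
  have ge: "m * (v \<bullet> v) \<le> ?q v" for v
  proof (cases "v = 0")
    case False
    then have "m \<le> ?q ((1 / norm v) *\<^sub>R v)"
      unfolding m_def by (intro min) simp
    also have "\<dots> = ?q v / (v \<bullet> v)"
      by (simp add: matrix_vector_mult_scaleR dot_square_norm power2_eq_square)
    finally show ?thesis using False by (simp add: field_simps)
  qed simp
  have eig: "(M - m *\<^sub>R mat 1) *v v = M *v v - m *\<^sub>R v" for v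
    by (simp add: matrix_vector_mult_diff_rdistrib scaleR_matrix_vector_assoc[symmetric])
  have uu: "u \<bullet> u = 1" using u by (simp add: dot_square_norm)
  have "transpose (M - m *\<^sub>R mat 1) = M - m *\<^sub>R mat 1"
    using sym by (auto simp: transpose_def vec_eq_iff mat_def)
  then have "(M - m *\<^sub>R mat 1) *v u = 0"
    by (rule psd_quadratic_form_zero) (use ge uu in \<open>auto simp: eig inner_diff_right m_def[symmetric]\<close>)
  then have "m \<in> ?E" using uu by (auto simp: eig intro!: exI[of _ u])
  then have "lambda_min M = m"
    unfolding lambda_min_def
  proof (intro Min_eqI symmetric_eigenvalues_finite[OF sym])
    fix l assume "l \<in> ?E"
    then obtain v where "v \<noteq> 0" "M *v v = l *\<^sub>R v" by blast
    then show "m \<le> l" using ge[of v] by simp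
  qed
  then show ?thesis using ge by simp
qed

lemma lambda_min_scaleR_mat_1: "lambda_min (l *\<^sub>R mat 1 :: real^'n^'n) = l"
proof -
  have "(l *\<^sub>R mat 1 :: real^'n^'n) *v v = l *\<^sub>R v" for v
    by (simp add: scaleR_matrix_vector_assoc[symmetric])
  moreover have "\<exists>v :: real^'n. v \<noteq> 0"
    by (rule exI[of _ "axis undefined 1"]) simp
  ultimately have "{k. \<exists>v. v \<noteq> 0 \<and> (l *\<^sub>R mat 1 :: real^'n^'n) *v v = k *\<^sub>R v} = {l}"
    by auto
  then show ?thesis by (simp add: lambda_min_def)
qed

section \<open>Comparison of entries, norm, trace and quadratic form\<close>

lemma psd_entry_le_trace:
  fixes N :: "real^'n^'n"
  assumes "positive_semidefinite N"
  shows "\<bar>N $ i $ j\<bar> \<le> trace N"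
proof -
  have sym: "N $ j $ i = N $ i $ j"
  proof -
    have "transpose N = N" using assms by (simp add: positive_semidefinite_def)
    then have "transpose N $ i $ j = N $ i $ j" by (rule arg_cong)
    then show ?thesis by (simp add: transpose_def)
  qed
  have form: "axis k 1 \<bullet> (N *v axis l 1) = N $ k $ l" for k l
    by (simp add: matrix_vector_mul_component inner_axis' inner_axis)
  have psd: "0 \<le> v \<bullet> (N *v v)" for v
    using assms by (simp add: positive_semidefinite_def)
  have diag: "0 \<le> N $ k $ k" for k
    using psd[of "axis k 1"] by (simp only: form)
  show ?thesis
  proof (cases "i = j")
    case True
    then show ?thesis
      using diag member_le_sum[of j UNIV "\<lambda>k. N $ k $ k"] by (simp add: trace_def)
  next
    \<comment> \<open>The form at \<open>axis i 1 + axis j 1\<close> and at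
      \<open>axis i 1 - axis j 1\<close> bounds twice the off-diagonal entry, in absolute value, by
      the sum of the two diagonal entries.\<close>
    case False
    have "0 \<le> N $ i $ i + N $ j $ j + 2 * N $ i $ j"
      using psd[of "axis i 1 + axis j 1"] sym
      by (simp add: matrix_vector_right_distrib inner_add_left inner_add_right form)
    moreover have "0 \<le> N $ i $ i + N $ j $ j - 2 * N $ i $ j"
      using psd[of "axis i 1 - axis j 1"] sym
      by (simp add: matrix_vector_mult_diff_distrib inner_diff_left inner_diff_right form)
    moreover have "N $ i $ i + N $ j $ j \<le> trace N"
      using False diag sum_mono2[of UNIV "{i, j}" "\<lambda>k. N $ k $ k"] by (simp add: trace_def)
    ultimately show ?thesis using diag[of i] diag[of j] by linarith
  qed
qed

lemma abs_entry_le_norm: "\<bar>(N :: real^'n^'n) $ i $ j\<bar> \<le> norm N"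
  by (rule order.trans[OF component_le_norm_cart Finite_Cartesian_Product.norm_nth_le])

lemma norm_matrix_le_sum: "norm (N :: real^'n^'n) \<le> (\<Sum>i\<in>UNIV. \<Sum>j\<in>UNIV. \<bar>N $ i $ j\<bar>)"
proof -
  have "norm N \<le> (\<Sum>i\<in>UNIV. norm (N $ i))"
    unfolding norm_vec_def by (rule L2_set_le_sum) simp
  also have "\<dots> \<le> (\<Sum>i\<in>UNIV. \<Sum>j\<in>UNIV. \<bar>N $ i $ j\<bar>)"
    by (intro sum_mono norm_le_l1_cart)
  finally show ?thesis .
qed

lemma psd_norm_le_trace:
  fixes N :: "real^'n^'n"
  assumes "positive_semidefinite N"
  shows "norm N \<le> real CARD('n) ^ 2 * trace N"
proof -
  have "norm N \<le> (\<Sum>i\<in>(UNIV :: 'n set). \<Sum>j\<in>(UNIV :: 'n set). trace N)"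
    by (rule order.trans[OF norm_matrix_le_sum]) (intro sum_mono psd_entry_le_trace assms)
  then show ?thesis by (simp add: power2_eq_square)
qed

lemma abs_trace_le: "\<bar>trace (E :: real^'n^'n)\<bar> \<le> real CARD('n) * norm E"
proof -
  have "\<bar>trace E\<bar> \<le> (\<Sum>i\<in>(UNIV :: 'n set). norm E)"
    unfolding trace_def by (rule order.trans[OF sum_abs sum_mono]) (rule abs_entry_le_norm)
  then show ?thesis by simp
qed

lemma abs_quadratic_form_le: "\<bar>v \<bullet> ((E :: real^'n^'n) *v v)\<bar> \<le> real CARD('n) ^ 2 * norm E * (v \<bullet> v)"
proof -
  have "\<bar>v \<bullet> (E *v v)\<bar> = \<bar>\<Sum>i\<in>UNIV. \<Sum>j\<in>UNIV. v $ i * (E $ i $ j * v $ j)\<bar>"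
    by (simp add: inner_vec_def matrix_vector_mult_def sum_distrib_left)
  also have "\<dots> \<le> (\<Sum>i\<in>(UNIV :: 'n set). \<Sum>j\<in>(UNIV :: 'n set). norm E * (v \<bullet> v))"
  proof (rule order.trans[OF sum_abs sum_mono], rule order.trans[OF sum_abs sum_mono])
    fix i j
    have "\<bar>v $ i * (E $ i $ j * v $ j)\<bar> = \<bar>E $ i $ j\<bar> * (\<bar>v $ i\<bar> * \<bar>v $ j\<bar>)"
      by (simp add: abs_mult)
    also have "\<dots> \<le> norm E * (norm v * norm v)"
      by (intro mult_mono abs_entry_le_norm component_le_norm_cart) auto
    finally show "\<bar>v $ i * (E $ i $ j * v $ j)\<bar> \<le> norm E * (v \<bullet> v)"
      by (simp add: dot_square_norm power2_eq_square)
  qed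
  finally show ?thesis by (simp add: power2_eq_square)
qed

subsection \<open>The maximizer for a small horizon\<close>

lemma linear_trace: "linear (trace :: real^'n^'n \<Rightarrow> real)"
  by (rule linearI) (simp_all add: trace_def sum.distrib sum_distrib_left)

lemma linear_transpose: "linear (transpose :: real^'n^'n \<Rightarrow> real^'n^'n)"
  by (rule linearI) (simp_all add: transpose_def vec_eq_iff)

lemma transpose_op_series:
  assumes "bounded_operator (lyapunov A) K" "\<And>k. \<bar>a k\<bar> \<le> 1" "\<bar>T\<bar> * K < 1" "transpose X = X"
  shows "transpose (op_series a (lyapunov A) T X) = op_series a (lyapunov A) T X"
proof -
  interpret bounded_operator "lyapunov A" K by fact
  have "(\<lambda>k. transpose ((a k * T ^ k) *\<^sub>R (lyapunov A ^^ k) X)) sums transpose (op_series a (lyapunov A) T X)"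
    by (rule bounded_linear.sums[OF linear_conv_bounded_linear[THEN iffD1, OF linear_transpose]])
      (rule op_series_sums[where a = a, OF assms(2,3)])
  then show ?thesis
    using op_series_sums[where a = a, OF assms(2,3), of X] assms(4)
    by (simp add: linear_scale[OF linear_transpose] transpose_lyapunov_funpow sums_unique2)
qed

text \<open>For small \<open>T > 0\<close> this is \<open>T\<close> times the preimage of the
  identity under the Gramian map. It is a function of every real \<open>t\<close>, so that
  analyticity at 0 can be stated.\<close>

abbreviation scaled_preimage :: "real^'n^'n \<Rightarrow> real \<Rightarrow> real^'n^'n" where
  "scaled_preimage A t \<equiv> op_series inv_coeff (lyapunov A) t (mat 1)"

text \<open>The power \<open>n ^ 5\<close> pays for the dimension factors below:
  \<open>n ^ 3\<close> for the trace and \<open>n ^ 5\<close> for the quadratic form. The factor 4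
  consists of a 2 that bounds \<open>1 / (1 - T * K)\<close> and a 2 that leaves the deviation at
  one half.\<close>

locale small_horizon =
  fixes A :: "real^'n^'n" and K T n :: real
  assumes n_def: "n = real CARD('n)"
    and bounded: "bounded_operator (lyapunov A) K"
    and T_pos: "0 < T"
    and small: "4 * n ^ 5 * (T * K) \<le> 1"
begin

sublocale bounded_operator "lyapunov A" K by (rule bounded)

abbreviation J where "J \<equiv> op_series inv_coeff (lyapunov A) T"

abbreviation P where "P \<equiv> scaled_preimage A T"

lemma n_ge_1: "1 \<le> n"
  unfolding n_def using zero_less_card_finite[where 'a = 'n] by linarith

lemma TK: "0 < T * K" "T * K \<le> 1 / 4"
proof -
  show pos: "0 < T * K" using T_pos K_pos by simp
  have "1 * (T * K) \<le> n ^ 5 * (T * K)"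
    using n_ge_1 pos by (intro mult_right_mono one_le_power) auto
  then show "T * K \<le> 1 / 4" using small by linarith
qed

lemma TK_less: "\<bar>T\<bar> * K < 1"
  using TK T_pos by simp

lemma abs_inverse_fact_le: "\<bar>1 / fact (Suc k)\<bar> \<le> (1 :: real)"
  by (simp add: fact_ge_1 del: fact_Suc)

lemma gramian_eq: "gramian A T X = T *\<^sub>R op_series (\<lambda>k. 1 / fact (Suc k)) (lyapunov A) T X"
  using TK by (intro gramian_eq_op_series[OF bounded]) (use T_pos in auto)

lemma J_gramian: "J (gramian A T X) = T *\<^sub>R X"
  unfolding gramian_eq linear_scale[OF linear_op_series[where a = inv_coeff, OF abs_inv_coeff_le TK_less]]
  using op_series_comp[where a = inv_coeff and b = "\<lambda>k. 1 / fact (Suc k)", OF abs_inv_coeff_le abs_inverse_fact_le TK_less inv_coeff_convolution'] by simp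

lemma gramian_J: "gramian A T (J X) = T *\<^sub>R X"
  unfolding gramian_eq
  using op_series_comp[where b = inv_coeff and a = "\<lambda>k. 1 / fact (Suc k)", OF abs_inverse_fact_le abs_inv_coeff_le TK_less inv_coeff_convolution] by simp

lemma transpose_gramian: "transpose X = X \<Longrightarrow> transpose (gramian A T X) = gramian A T X"
  unfolding gramian_eq
  using transpose_op_series[where a = "\<lambda>k. 1 / fact (Suc k)", OF bounded abs_inverse_fact_le TK_less]
  by (simp add: linear_scale[OF linear_transpose])

lemma norm_J_diff_le: "n ^ 5 * norm (J X - X) \<le> norm X / 2"
proof -
  have "norm (J X - X) \<le> (T * K) / (1 - T * K) * norm X"
    using op_series_remainder[where a = inv_coeff, OF abs_inv_coeff_le TK_less, of X 1] T_pos by (simp add: inv_coeff_simps)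
  also have "\<dots> \<le> (T * K) / (1 / 2) * norm X"
    using TK by (intro mult_right_mono divide_left_mono) auto
  finally have "n ^ 5 * norm (J X - X) \<le> n ^ 5 * (2 * (T * K) * norm X)"
    using n_ge_1 by (intro mult_left_mono) auto
  also have "\<dots> = (4 * n ^ 5 * (T * K)) * (norm X / 2)" by simp
  also have "\<dots> \<le> 1 * (norm X / 2)" using small by (intro mult_right_mono) auto
  finally show ?thesis by simp
qed

text \<open>The deviation of the trace is at most \<open>n * norm (J X - X)\<close>, and positivity
  bounds \<open>norm X\<close> by \<open>n ^ 2 * trace X\<close>; so the change under
  \<open>J\<close> is at most half of \<open>trace X\<close>. For indefinite \<open>X\<close> the
  trace would not control the norm.\<close>

lemma trace_J_ge:
  assumes "positive_semidefinite X"
  shows "trace X / 2 \<le> trace (J X)"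
proof -
  have tr: "0 \<le> trace X" using psd_entry_le_trace[OF assms] abs_ge_zero order.trans by blast
  have "n ^ 2 * \<bar>trace (J X - X)\<bar> \<le> n ^ 2 * (n * norm (J X - X))"
    by (intro mult_left_mono abs_trace_le[where 'n = 'n, folded n_def]) auto
  also have "\<dots> = n ^ 3 * norm (J X - X)" by (simp add: power2_eq_square power3_eq_cube)
  also have "\<dots> \<le> n ^ 5 * norm (J X - X)"
    using n_ge_1 by (intro mult_right_mono power_increasing) auto
  also have "\<dots> \<le> norm X / 2" by (rule norm_J_diff_le)
  also have "\<dots> \<le> n ^ 2 * (trace X / 2)" using psd_norm_le_trace[OF assms, folded n_def] by simp
  finally have "\<bar>trace (J X - X)\<bar> \<le> trace X / 2" using n_ge_1 by simp
  then show ?thesis unfolding linear_diff[OF linear_trace] by linarith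
qed

lemma psd_mat_1: "positive_semidefinite (mat 1 :: real^'n^'n)"
  by (simp add: positive_semidefinite_def)

lemma trace_P_pos: "0 < trace P"
  using trace_J_ge[OF psd_mat_1] n_ge_1 by (simp add: trace_I flip: n_def)

lemma transpose_P: "transpose P = P"
  by (intro transpose_op_series[OF bounded abs_inv_coeff_le TK_less]) simp

text \<open>As a quadratic form, \<open>P\<close> differs from the identity by at most one half.
  This gives both the positivity of \<open>X_opt\<close> and its full rank.\<close>

lemma quadratic_form_P: "v \<bullet> v \<le> 2 * (v \<bullet> (P *v v))"
proof -
  let ?E = "P - mat 1"
  have "n ^ 3 * \<bar>v \<bullet> (?E *v v)\<bar> \<le> n ^ 3 * (n ^ 2 * norm ?E * (v \<bullet> v))"
    using n_ge_1 by (intro mult_left_mono abs_quadratic_form_le[where 'n = 'n, folded n_def]) auto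
  also have "\<dots> = (n ^ 5 * norm ?E) * (v \<bullet> v)"
    by (simp add: power_numeral_reduce)
  also have "\<dots> \<le> (norm (mat 1 :: real^'n^'n) / 2) * (v \<bullet> v)"
    by (intro mult_right_mono norm_J_diff_le) auto
  \<comment> \<open>The identity is positive semidefinite of trace \<open>n\<close>, so its norm is
    at most \<open>n ^ 2 * n\<close>.\<close>
  also have "\<dots> \<le> (n ^ 3 / 2) * (v \<bullet> v)"
    using psd_norm_le_trace[OF psd_mat_1, folded n_def]
    by (intro mult_right_mono) (auto simp: trace_I n_def power_numeral_reduce)
  finally have "n ^ 3 * \<bar>v \<bullet> (?E *v v)\<bar> \<le> n ^ 3 * ((v \<bullet> v) / 2)" by simp
  then have "\<bar>v \<bullet> (?E *v v)\<bar> \<le> (v \<bullet> v) / 2" using n_ge_1 by simp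
  then have "\<bar>v \<bullet> (P *v v) - v \<bullet> v\<bar> \<le> (v \<bullet> v) / 2"
    by (simp add: matrix_vector_mult_diff_rdistrib inner_diff_right)
  then show ?thesis by linarith
qed

definition X_opt where "X_opt = (1 / trace P) *\<^sub>R P"

lemma covariance_X_opt: "covariance_matrix X_opt"
proof -
  have "0 \<le> v \<bullet> (P *v v)" for v
    using quadratic_form_P[of v] inner_ge_zero[of v] by linarith
  then show ?thesis
    using trace_P_pos transpose_P
    by (auto simp: covariance_matrix_def positive_semidefinite_def X_opt_def linear_scale[OF linear_trace]
        linear_scale[OF linear_transpose] scaleR_matrix_vector_assoc[symmetric])
qed

lemma gramian_X_opt: "gramian A T X_opt = (T / trace P) *\<^sub>R mat 1"
proof -
  have "X_opt = J ((1 / trace P) *\<^sub>R mat 1)"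
    by (simp add: X_opt_def linear_scale[OF linear_op_series[where a = inv_coeff, OF abs_inv_coeff_le TK_less]])
  then show ?thesis by (simp add: gramian_J)
qed

lemma lambda_min_X_opt: "lambda_min (gramian A T X_opt) = T / trace P"
  by (simp add: gramian_X_opt lambda_min_scaleR_mat_1)

text \<open>The excess \<open>N = gramian A T X - l *\<^sub>R mat 1\<close> is positive semidefinite, and applying the trace to
  \<open>T *\<^sub>R X = J N + l *\<^sub>R P\<close> gives \<open>T = trace (J N) + l * trace P\<close> with \<open>trace (J N) \<ge> trace N / 2\<close>.\<close>

lemma lambda_min_gramian_le:
  assumes X: "covariance_matrix X"
  shows "lambda_min (gramian A T X) \<le> T / trace P"
    and "lambda_min (gramian A T X) = T / trace P \<Longrightarrow> X = X_opt"
proof -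
  define l where "l = lambda_min (gramian A T X)"
  define N where "N = gramian A T X - l *\<^sub>R mat 1"
  have X': "transpose X = X" "trace X = 1"
    using X by (auto simp: covariance_matrix_def positive_semidefinite_def)
  have psd: "positive_semidefinite N"
    unfolding positive_semidefinite_def
  proof (intro conjI allI)
    show "transpose N = N"
      by (simp add: N_def linear_diff[OF linear_transpose] linear_scale[OF linear_transpose] transpose_gramian X')
    show "0 \<le> v \<bullet> (N *v v)" for v
      using lambda_min_rayleigh[OF transpose_gramian[OF X'(1)], of v]
      by (simp add: N_def matrix_vector_mult_diff_rdistrib scaleR_matrix_vector_assoc[symmetric]
          inner_diff_right l_def)
  qed
  have TX: "T *\<^sub>R X = J N + l *\<^sub>R P"
    using linear_op_series[where a = inv_coeff, OF abs_inv_coeff_le TK_less]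
    by (simp add: N_def linear_diff linear_scale J_gramian)
  have "T = trace (J N) + l * trace P"
    using arg_cong[OF TX, of trace] X'
    by (simp add: linear_add[OF linear_trace] linear_scale[OF linear_trace])
  moreover have tr: "trace N / 2 \<le> trace (J N)" by (rule trace_J_ge[OF psd])
  moreover have tr0: "0 \<le> trace N" using psd_entry_le_trace[OF psd] abs_ge_zero order.trans by blast
  ultimately show "lambda_min (gramian A T X) \<le> T / trace P"
    unfolding l_def[symmetric] using trace_P_pos by (simp add: field_simps)
  \<comment> \<open>Equality leaves nothing for \<open>trace (J N)\<close>, so
    \<open>trace N\<close> vanishes; a positive semidefinite matrix of trace 0 is 0, and
    \<open>T *\<^sub>R X\<close> is a multiple of \<open>P\<close>.\<close>
  assume "lambda_min (gramian A T X) = T / trace P"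
  then have l: "l = T / trace P" by (simp add: l_def)
  with \<open>T = trace (J N) + l * trace P\<close> trace_P_pos have "trace (J N) = 0" by simp
  with tr tr0 have "trace N = 0" by simp
  then have "N = 0" using psd_norm_le_trace[OF psd, folded n_def] by simp
  then have "T *\<^sub>R X = l *\<^sub>R P"
    using TX linear_op_series[where a = inv_coeff, OF abs_inv_coeff_le TK_less] by (simp add: linear_0)
  then have "T *\<^sub>R X = T *\<^sub>R X_opt" by (simp add: l X_opt_def)
  then show "X = X_opt" using T_pos by simp
qed

lemma gamma_rel_eq: "gamma_rel A T = T / trace P"
  unfolding gamma_rel_def
  by (rule Greatest_equality)
    (use covariance_X_opt lambda_min_X_opt lambda_min_gramian_le(1) in \<open>auto intro!: exI[of _ X_opt]\<close>)

lemma relaxed_maximizer_iff: "relaxed_maximizer A T X \<longleftrightarrow> X = X_opt"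
  unfolding relaxed_maximizer_def gamma_rel_eq
  using covariance_X_opt lambda_min_X_opt lambda_min_gramian_le(2) by blast

text \<open>The minimum runs over a single matrix, since the maximizer is unique, and the lower
  bound on the form of \<open>P\<close> makes its kernel trivial.\<close>

lemma recovery_rank_eq: "recovery_rank A T = CARD('n)"
proof -
  have "P *v v = 0 \<Longrightarrow> v = 0" for v
    using quadratic_form_P[of v] by (metis inner_zero_right inner_gt_zero_iff mult_zero_right not_le)
  then have "X_opt *v v = 0 \<Longrightarrow> v = 0" for v
    using trace_P_pos by (simp add: X_opt_def scaleR_matrix_vector_assoc[symmetric])
  then have "rank X_opt = CARD('n)"
    using matrix_nonfull_linear_equations_eq[of X_opt] by blast
  then show ?thesis
    unfolding recovery_rank_def relaxed_maximizer_iff by (auto intro: Least_equality)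
qed

end

subsection \<open>Analyticity and expansions\<close>

text \<open>Analyticity is inherited from holomorphic functions on a complex disc: around
  \<open>x\<close> the Taylor series of each \<open>G i j\<close> converges on the disc of radius
  \<open>r - \<bar>x\<bar>\<close>. As \<open>y - x\<close> is real, taking real parts acts on the
  coefficients alone.\<close>

lemma real_analytic_on_matrix:
  fixes X :: "real \<Rightarrow> real^'n^'m" and G :: "'m \<Rightarrow> 'n \<Rightarrow> complex \<Rightarrow> complex"
  assumes G: "\<And>i j. G i j holomorphic_on ball 0 r"
    and X: "\<And>i j t. \<bar>t\<bar> < r \<Longrightarrow> X t $ i $ j = Re (G i j (of_real t))"
  shows "real_analytic_on X {-r<..<r}"
  unfolding real_analytic_on_def
proof (intro ballI exI conjI allI impI)
  fix x y :: real
  assume x: "x \<in> {-r<..<r}"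
  show "0 < r - \<bar>x\<bar>" using x by auto
  assume y: "\<bar>y - x\<bar> < r - \<bar>x\<bar>"
  define c where "c k = (\<chi> i j. Re ((deriv ^^ k) (G i j) (of_real x) / fact k))" for k
  have "(\<lambda>N. (\<Sum>k<N. (y - x) ^ k *\<^sub>R c k) $ i $ j) \<longlonglongrightarrow> X y $ i $ j" for i j
  proof -
    have "ball (of_real x :: complex) (r - \<bar>x\<bar>) \<subseteq> ball 0 r"
    proof
      fix z :: complex assume z: "z \<in> ball (of_real x) (r - \<bar>x\<bar>)"
      have "norm z \<le> norm (z - of_real x) + norm (of_real x :: complex)" by norm
      then show "z \<in> ball 0 r" using z by (simp add: dist_norm norm_minus_commute)
    qed
    then have hol: "G i j holomorphic_on ball (of_real x) (r - \<bar>x\<bar>)"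
      using G holomorphic_on_subset by blast
    have "(of_real y :: complex) \<in> ball (of_real x) (r - \<bar>x\<bar>)"
      using y by (simp add: dist_of_real dist_real_def abs_minus_commute)
    then have "(\<lambda>k. (deriv ^^ k) (G i j) (of_real x) / fact k * (of_real y - of_real x) ^ k) sums G i j (of_real y)"
      by (rule holomorphic_power_series[OF hol])
    then have "(\<lambda>k. Re ((deriv ^^ k) (G i j) (of_real x) / fact k * (of_real y - of_real x) ^ k)) sums Re (G i j (of_real y))"
      by (rule sums_Re)
    moreover have "Re (w * (of_real y - of_real x) ^ k) = (y - x) ^ k * Re w" for w :: complex and k
      by (simp flip: of_real_diff of_real_power)
    moreover have "X y $ i $ j = Re (G i j (of_real y))"
      using y by (intro X) auto
    ultimately have "(\<lambda>k. (y - x) ^ k * c k $ i $ j) sums (X y $ i $ j)"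
      by (simp only: c_def vec_lambda_beta)
    then show ?thesis by (simp add: sums_def)
  qed
  then show "(\<lambda>k. (y - x) ^ k *\<^sub>R c k) sums X y"
    unfolding sums_def by (intro vec_tendstoI)
qed

lemma holomorphic_extension_power_series:
  fixes a :: "nat \<Rightarrow> real"
  assumes K: "0 < K" and a: "\<And>k. \<bar>a k\<bar> \<le> C * K ^ k"
  shows "\<exists>F. F holomorphic_on ball 0 (1 / K) \<and>
    (\<forall>t s. \<bar>t\<bar> < 1 / K \<longrightarrow> (\<lambda>k. a k * t ^ k) sums s \<longrightarrow> F (of_real t) = complex_of_real s)"
proof -
  define F where "F z = (\<Sum>k. of_real (a k) * z ^ k)" for z :: complex
  have sm: "summable (\<lambda>k. of_real (a k) * z ^ k)" if z: "norm z < 1 / K" for z :: complex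
  proof (rule summable_comparison_test'[where g = "\<lambda>k. C * (K * norm z) ^ k" and N = 0])
    show "summable (\<lambda>k. C * (K * norm z) ^ k)"
      using z K by (intro summable_mult summable_geometric) (simp add: abs_mult field_simps)
    show "norm (of_real (a k) * z ^ k) \<le> C * (K * norm z) ^ k" for k
      using mult_right_mono[OF a[of k], of "norm z ^ k"] by (simp add: norm_mult norm_power power_mult_distrib mult.assoc)
  qed
  have "F holomorphic_on ball 0 (1 / K)"
  proof (rule power_series_holomorphic)
    fix w :: complex assume "w \<in> ball 0 (1 / K)"
    then have "summable (\<lambda>k. of_real (a k) * w ^ k)" by (intro sm) simp
    then show "(\<lambda>n. of_real (a n) * (w - 0) ^ n) sums F w" by (simp add: F_def summable_sums)
  qed
  moreover have "F (of_real t) = of_real s" if "(\<lambda>k. a k * t ^ k) sums s" for t s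
  proof -
    have "(\<lambda>k. complex_of_real (a k * t ^ k)) sums of_real s"
      using that by (rule sums_of_real)
    then show ?thesis by (simp add: F_def sums_iff)
  qed
  ultimately show ?thesis by blast
qed

text \<open>The equations \<open>g\<close> say that the product of the truncations of
  \<open>p\<close> and of the quotient agrees with that of \<open>f\<close> up to order 2. So
  \<open>f t\<close> minus \<open>p t\<close> times the claimed polynomial is of order 3, and
  division by \<open>p\<close> preserves this because \<open>p\<close> tends to \<open>p0\<close>,
  which is nonzero.\<close>

lemma ratio_expansion_at_right:
  fixes f p :: "real \<Rightarrow> real"
  assumes f: "(\<lambda>t. f t - (f0 + f1 * t + f2 * t ^ 2)) \<in> O[at_right 0](\<lambda>t. t ^ 3)"
    and p: "(\<lambda>t. p t - (p0 + p1 * t + p2 * t ^ 2)) \<in> O[at_right 0](\<lambda>t. t ^ 3)"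
    and p0: "p0 \<noteq> 0"
    and g: "f0 = p0 * g0" "f1 = p0 * g1 + p1 * g0" "f2 = p0 * g2 + p1 * g1 + p2 * g0"
  shows "(\<lambda>t. f t / p t - (g0 + g1 * t + g2 * t ^ 2)) \<in> O[at_right 0](\<lambda>t. t ^ 3)"
proof -
  let ?f = "\<lambda>t. f0 + f1 * t + f2 * t ^ 2" and ?p = "\<lambda>t. p0 + p1 * t + p2 * t ^ 2"
    and ?g = "\<lambda>t. g0 + g1 * t + g2 * t ^ 2"
  have bounded: "h \<in> O[at_right 0](\<lambda>_. 1)" if "(h \<longlongrightarrow> l) (at_right 0)" for h :: "real \<Rightarrow> real" and l
    using that by (intro bigoI_tendsto[where c = l]) auto
  have "(\<lambda>t :: real. t ^ 3) \<in> o[at_right 0](\<lambda>_. 1)"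
    by (rule smalloI_tendsto) (auto intro!: tendsto_eq_intros)
  then have "((\<lambda>t. (p t - ?p t) / 1) \<longlongrightarrow> 0) (at_right 0)"
    using p by (intro smalloD_tendsto) (rule landau_o.big_small_trans)
  moreover have "(?p \<longlongrightarrow> p0) (at_right 0)"
    by (auto intro!: tendsto_eq_intros)
  ultimately have "((\<lambda>t. (p t - ?p t) / 1 + ?p t) \<longlongrightarrow> 0 + p0) (at_right 0)"
    by (rule tendsto_add)
  then have lim: "(p \<longlongrightarrow> p0) (at_right 0)" by simp
  then have nz: "eventually (\<lambda>t. p t \<noteq> 0) (at_right 0)"
    using p0 by (rule tendsto_imp_eventually_ne)
  have inv: "(\<lambda>t. 1 / p t) \<in> O[at_right 0](\<lambda>_. 1)"
    using lim p0 by (intro bounded) (auto intro!: tendsto_intros)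
  have "(\<lambda>t. (p t - ?p t) * ?g t) \<in> O[at_right 0](\<lambda>t. t ^ 3 * 1)"
    by (intro landau_o.big_mult p bounded[where l = g0]) (auto intro!: tendsto_eq_intros)
  moreover have "(\<lambda>t. t ^ 3 * (p1 * g2 + p2 * g1 + p2 * g2 * t)) \<in> O[at_right 0](\<lambda>t. t ^ 3 * 1)"
    by (intro landau_o.big_mult bounded[where l = "p1 * g2 + p2 * g1"]) (auto intro!: tendsto_eq_intros)
  ultimately have "(\<lambda>t. f t - ?f t - (p t - ?p t) * ?g t - t ^ 3 * (p1 * g2 + p2 * g1 + p2 * g2 * t))
      \<in> O[at_right 0](\<lambda>t. t ^ 3)"
    unfolding mult_1_right by (rule sum_in_bigo(2)[OF sum_in_bigo(2)[OF f]])
  \<comment> \<open>After substitution of \<open>g\<close>, the difference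
    \<open>?p t * ?g t - ?f t\<close> is exactly the displayed multiple of
    \<open>t ^ 3\<close>.\<close>
  also have "(\<lambda>t. f t - ?f t - (p t - ?p t) * ?g t - t ^ 3 * (p1 * g2 + p2 * g1 + p2 * g2 * t)) =
      (\<lambda>t. f t - p t * ?g t)"
    unfolding g by (intro ext) algebra
  finally have "(\<lambda>t. (f t - p t * ?g t) * (1 / p t)) \<in> O[at_right 0](\<lambda>t. t ^ 3 * 1)"
    using inv by (rule landau_o.big_mult)
  moreover have "eventually (\<lambda>t. (f t - p t * ?g t) * (1 / p t) = f t / p t - ?g t) (at_right 0)"
    using nz by eventually_elim (simp add: diff_divide_distrib)
  ultimately show ?thesis
    using landau_o.big.in_cong by fastforce
qed

context
  fixes A :: "real^'n^'n" and K :: real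
  assumes bounded: "bounded_operator (lyapunov A) K"
begin

interpretation bounded_operator "lyapunov A" K by (rule bounded)

lemma scaled_preimage_holomorphic_extension:
  "\<exists>F. F holomorphic_on ball 0 (1 / K) \<and> (\<forall>t. \<bar>t\<bar> < 1 / K \<longrightarrow> F (of_real t) = complex_of_real (scaled_preimage A t $ i $ j))"
proof -
  have "\<bar>inv_coeff k * (lyapunov A ^^ k) (mat 1) $ i $ j\<bar> \<le> norm (mat 1 :: real^'n^'n) * K ^ k" for k
  proof -
    have "\<bar>inv_coeff k * (lyapunov A ^^ k) (mat 1) $ i $ j\<bar> \<le> 1 * (K ^ k * norm (mat 1 :: real^'n^'n))"
      unfolding abs_mult
      by (intro mult_mono abs_inv_coeff_le order.trans[OF abs_entry_le_norm norm_funpow_le]) auto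
    then show ?thesis by (simp add: mult.commute)
  qed
  from holomorphic_extension_power_series[OF K_pos this] obtain F where
    F: "F holomorphic_on ball 0 (1 / K)"
    and eq: "\<And>t s. \<bar>t\<bar> < 1 / K \<Longrightarrow> (\<lambda>k. inv_coeff k * (lyapunov A ^^ k) (mat 1) $ i $ j * t ^ k) sums s \<Longrightarrow>
      F (of_real t) = complex_of_real s"
    by blast
  have "F (of_real t) = complex_of_real (scaled_preimage A t $ i $ j)" if t: "\<bar>t\<bar> < 1 / K" for t
  proof (rule eq[OF t])
    have "\<bar>t\<bar> * K < 1" using t K_pos by (simp add: field_simps)
    then have "(\<lambda>k. (inv_coeff k * t ^ k) *\<^sub>R (lyapunov A ^^ k) (mat 1)) sums scaled_preimage A t"
      by (rule op_series_sums[where a = inv_coeff, OF abs_inv_coeff_le])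
    then have "(\<lambda>k. ((inv_coeff k * t ^ k) *\<^sub>R (lyapunov A ^^ k) (mat 1)) $ i $ j) sums (scaled_preimage A t $ i $ j)"
      by (intro sums_vec_nth)
    then show "(\<lambda>k. inv_coeff k * (lyapunov A ^^ k) (mat 1) $ i $ j * t ^ k) sums (scaled_preimage A t $ i $ j)"
      by (simp add: mult_ac)
  qed
  with F show ?thesis by blast
qed

text \<open>The entries and the trace extend holomorphically, and the extended trace is nonzero at
  0, hence nearby; the quotients are therefore holomorphic on a disc. Allowing every smaller
  \<open>s\<close> lets the radius be matched with the horizon later.\<close>

lemma real_analytic_normalized_preimage:
  "\<exists>r>0. \<forall>s. 0 < s \<longrightarrow> s \<le> r \<longrightarrow> real_analytic_on (\<lambda>t. (1 / trace (scaled_preimage A t)) *\<^sub>R scaled_preimage A t) {-s<..<s}"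
proof -
  have "\<exists>F. \<forall>i j. F i j holomorphic_on ball 0 (1 / K) \<and>
      (\<forall>t. \<bar>t\<bar> < 1 / K \<longrightarrow> F i j (of_real t) = complex_of_real (scaled_preimage A t $ i $ j))"
    using scaled_preimage_holomorphic_extension by metis
  then obtain F where F: "\<And>i j. F i j holomorphic_on ball 0 (1 / K)"
    and FP: "\<And>i j t. \<bar>t\<bar> < 1 / K \<Longrightarrow> F i j (of_real t) = complex_of_real (scaled_preimage A t $ i $ j)"
    by blast
  define q where "q z = (\<Sum>i\<in>UNIV. F i i z)" for z
  have q: "q holomorphic_on ball 0 (1 / K)"
    unfolding q_def by (intro holomorphic_intros F)
  have qP: "q (of_real t) = complex_of_real (trace (scaled_preimage A t))" if "\<bar>t\<bar> < 1 / K" for t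
    using that by (simp add: q_def FP trace_def)
  have "scaled_preimage A 0 = mat 1"
    unfolding op_series_def using suminf_finite[of "{0}" "\<lambda>k. (inv_coeff k * 0 ^ k) *\<^sub>R (lyapunov A ^^ k) (mat 1)"]
    by (simp add: inv_coeff_simps)
  then have "q 0 \<noteq> 0"
    using qP[of 0] K_pos by (simp add: trace_I)
  moreover have "continuous_on (ball 0 (1 / K)) q"
    by (rule holomorphic_on_imp_continuous_on[OF q])
  ultimately obtain d where d: "0 < d" "\<And>z. z \<in> ball 0 (1 / K) \<Longrightarrow> dist 0 z < d \<Longrightarrow> q z \<noteq> 0"
    using continuous_on_avoid[of "ball 0 (1 / K)" q 0 0] K_pos by auto
  have "real_analytic_on (\<lambda>t. (1 / trace (scaled_preimage A t)) *\<^sub>R scaled_preimage A t) {-s<..<s}" if s: "s \<le> min d (1 / K)" for s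
  proof (rule real_analytic_on_matrix[where G = "\<lambda>i j z. F i j z / q z"])
    have sub: "ball 0 s \<subseteq> ball 0 (1 / K)" using s by auto
    show "(\<lambda>z. F i j z / q z) holomorphic_on ball 0 s" for i j
      using d(2) s sub
      by (intro holomorphic_on_divide holomorphic_on_subset[OF F sub] holomorphic_on_subset[OF q sub]) auto
    show "((1 / trace (scaled_preimage A t)) *\<^sub>R scaled_preimage A t) $ i $ j = Re (F i j (of_real t) / q (of_real t))" if "\<bar>t\<bar> < s" for i j t
      using that s by (simp add: FP qP flip: of_real_divide)
  qed
  moreover have "0 < min d (1 / K)" using d(1) K_pos by simp
  ultimately show ?thesis by blast
qed

text \<open>Three terms of the series with coefficients 1, -1/2, 1/12, where
  \<open>lyapunov A\<close> is applied once and twice to the identity. For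
  \<open>t * K < 1 / 2\<close> the geometric remainder is at most \<open>2 * (t * K) ^ 3\<close>
  times the norm of the identity.\<close>

lemma scaled_preimage_expansion:
  "(\<lambda>t. norm (scaled_preimage A t - (mat 1 - (t / 2) *\<^sub>R (A + transpose A)
      + (t ^ 2 / 12) *\<^sub>R (A ** A + 2 *\<^sub>R (A ** transpose A) + transpose A ** transpose A))))
    \<in> O[at_right 0](\<lambda>t. t ^ 3)" (is "(\<lambda>t. norm (scaled_preimage A t - ?Q t)) \<in> _")
proof -
  let ?c = "2 * K ^ 3 * norm (mat 1 :: real^'n^'n)"
  have L1: "lyapunov A (mat 1) = A + transpose A"
    by (simp add: lyapunov_def)
  have L2: "lyapunov A (A + transpose A) = A ** A + 2 *\<^sub>R (A ** transpose A) + transpose A ** transpose A"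
    by (simp add: lyapunov_def mm.add_left mm.add_right scaleR_2)
  have Q: "(\<Sum>i<3. (inv_coeff i * t ^ i) *\<^sub>R (lyapunov A ^^ i) (mat 1)) = ?Q t" for t
    using inv_coeff_simps by (simp add: numeral_3_eq_3 numeral_2_eq_2 L1 L2)
  have "norm (scaled_preimage A t - ?Q t) \<le> ?c * norm (t ^ 3)" if t: "0 < t" "t < 1 / (2 * K)" for t
  proof -
    have tK: "t * K < 1 / 2" using t K_pos by (simp add: field_simps)
    then have "norm (scaled_preimage A t - ?Q t) \<le> (t * K) ^ 3 / (1 - t * K) * norm (mat 1 :: real^'n^'n)"
      using op_series_remainder[where a = inv_coeff and t = t and x = "mat 1" and m = 3, OF abs_inv_coeff_le] t
      unfolding Q by simp
    also have "\<dots> \<le> (t * K) ^ 3 / (1 / 2) * norm (mat 1 :: real^'n^'n)"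
      using tK t K_pos by (intro mult_right_mono divide_left_mono) auto
    finally show ?thesis using t by (simp add: power_mult_distrib mult_ac)
  qed
  then have "eventually (\<lambda>t. norm (scaled_preimage A t - ?Q t) \<le> ?c * norm (t ^ 3)) (at_right 0)"
    using K_pos by (intro eventually_at_rightI[of 0 "1 / (2 * K)"]) auto
  then show ?thesis by (intro bigoI) simp
qed

end

section \<open>Passage from the exact formulas at a small horizon to the expansions\<close>

theorem theorem2p2:
  fixes A S R :: "real^'n^'n" and n c :: real
  defines "n \<equiv> real CARD('n)"
    and "S \<equiv> (1 / 2) *\<^sub>R (A + transpose A)"
    and "c \<equiv> trace A / n"
    and "R \<equiv> A ** A + 2 *\<^sub>R (A ** transpose A) + transpose A ** transpose A"
  shows "(\<lambda>T. gamma_rel A T -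
             (T / n + trace A / n ^ 2 * T ^ 2
              + ((trace A) ^ 2 / n ^ 3 - trace R / (12 * n ^ 2)) * T ^ 3))
           \<in> O[at_right 0](\<lambda>T. T ^ 4)
    \<and> (\<exists>T0>0. \<exists>X :: real \<Rightarrow> real^'n^'n.
          (\<forall>T\<in>{0<..<T0}. relaxed_maximizer A T (X T)
              \<and> (\<forall>Y. relaxed_maximizer A T Y \<longrightarrow> Y = X T))
        \<and> real_analytic_on X {-T0<..<T0}
        \<and> (\<lambda>T. norm (X T - (1 / n) *\<^sub>R
                 (mat 1 + T *\<^sub>R (c *\<^sub>R mat 1 - S)
                  + T ^ 2 *\<^sub>R ((c ^ 2 - trace R / (12 * n)) *\<^sub>R mat 1
                               - c *\<^sub>R S + (1 / 12) *\<^sub>R R))))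
            \<in> O[at_right 0](\<lambda>T. T ^ 3))
    \<and> (\<exists>T0>0. \<forall>T\<in>{0<..<T0}. recovery_rank A T = CARD('n))"
proof -
  obtain K where K: "bounded_operator (lyapunov A) K"
    using bounded_operator_lyapunov by blast
  then interpret bounded_operator "lyapunov A" K .
  let ?P = "scaled_preimage A"
  \<comment> \<open>This curve is defined on both sides of 0, as analyticity there requires; it is
    identified with \<open>X_opt\<close> only for \<open>0 < T < \<delta>\<close>.\<close>
  define X where "X t = (1 / trace (?P t)) *\<^sub>R ?P t" for t
  define \<rho> where "\<rho> = trace R / (12 * n)"
  define \<delta> where "\<delta> = 1 / (4 * n ^ 5 * K)"
  have n: "0 < n" by (simp add: n_def)
  have \<delta>: "0 < \<delta>" using n K_pos by (simp add: \<delta>_def)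
  have horizon: "small_horizon A K T n" if "T \<in> {0<..<\<delta>}" for T
    using that K n K_pos by (intro small_horizon.intro) (auto simp: \<delta>_def n_def field_simps)
  have near0: "eventually (\<lambda>T. T \<in> {0<..<\<delta>}) (at_right 0)"
    using \<delta> by (intro eventually_at_rightI[of 0 \<delta>]) auto

  define Q where "Q t = mat 1 - t *\<^sub>R S + (t ^ 2 / 12) *\<^sub>R R" for t
  have PQ: "(\<lambda>t. norm (?P t - Q t)) \<in> O[at_right 0](\<lambda>t. t ^ 3)"
    using scaled_preimage_expansion[OF K] by (simp add: Q_def S_def R_def)
  have entry: "(\<lambda>t. ?P t $ i $ j - ((mat 1 :: real^'n^'n) $ i $ j + (- S $ i $ j) * t + (R $ i $ j / 12) * t ^ 2))
      \<in> O[at_right 0](\<lambda>t. t ^ 3)" for i j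
  proof (rule landau_o.big.trans[OF _ PQ], rule bigoI[where c = 1], rule always_eventually, rule allI)
    fix t
    have "?P t $ i $ j - ((mat 1 :: real^'n^'n) $ i $ j + (- S $ i $ j) * t + (R $ i $ j / 12) * t ^ 2) = (?P t - Q t) $ i $ j"
      by (simp add: Q_def)
    then show "norm (?P t $ i $ j - ((mat 1 :: real^'n^'n) $ i $ j + (- S $ i $ j) * t + (R $ i $ j / 12) * t ^ 2))
        \<le> 1 * norm (norm (?P t - Q t))"
      using abs_entry_le_norm[of "?P t - Q t" i j] by simp
  qed
  have "(\<lambda>t. \<Sum>i\<in>UNIV. ?P t $ i $ i - ((mat 1 :: real^'n^'n) $ i $ i + (- S $ i $ i) * t + (R $ i $ i / 12) * t ^ 2))
      \<in> O[at_right 0](\<lambda>t. t ^ 3)"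
    by (intro big_sum_in_bigo entry)
  moreover have "trace S = c * n"
    using n by (simp add: S_def c_def linear_scale[OF linear_trace] linear_add[OF linear_trace] trace_def transpose_def)
  moreover have "trace R = 12 * n * \<rho>"
    using n by (simp add: \<rho>_def)
  ultimately have tr: "(\<lambda>t. trace (?P t) - (n + (- (c * n)) * t + (n * \<rho>) * t ^ 2)) \<in> O[at_right 0](\<lambda>t. t ^ 3)"
    by (simp add: trace_def mat_def n_def sum_subtractf sum.distrib sum_negf sum_distrib_right[symmetric]
        sum_divide_distrib[symmetric] mult.assoc)

  \<comment> \<open>The constant function 1 is divided by the expansion of
    \<open>trace (?P t)\<close>. Multiplication by \<open>t\<close> then raises the error to order 4
    and yields the expansion of \<open>gamma_rel\<close>.\<close>
  have "(\<lambda>t. 1 / trace (?P t) - (1 / n + c / n * t + (c ^ 2 - \<rho>) / n * t ^ 2)) \<in> O[at_right 0](\<lambda>t. t ^ 3)"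
    by (rule ratio_expansion_at_right[OF _ tr, where f = "\<lambda>_. 1" and ?f0.0 = 1 and ?f1.0 = 0 and ?f2.0 = 0])
      (use n in \<open>simp_all add: field_simps power2_eq_square\<close>)
  then have "(\<lambda>t. t * (1 / trace (?P t) - (1 / n + c / n * t + (c ^ 2 - \<rho>) / n * t ^ 2))) \<in> O[at_right 0](\<lambda>t. t * t ^ 3)"
    by (intro landau_o.big_mult) simp_all
  moreover have "eventually (\<lambda>T. T * (1 / trace (?P T) - (1 / n + c / n * T + (c ^ 2 - \<rho>) / n * T ^ 2)) =
      gamma_rel A T - (T / n + trace A / n ^ 2 * T ^ 2
              + ((trace A) ^ 2 / n ^ 3 - trace R / (12 * n ^ 2)) * T ^ 3)) (at_right 0)"
    using near0
  proof eventually_elim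
    case (elim T)
    have "T * (1 / n + c / n * T + (c ^ 2 - \<rho>) / n * T ^ 2) = T / n + trace A / n ^ 2 * T ^ 2
              + ((trace A) ^ 2 / n ^ 3 - trace R / (12 * n ^ 2)) * T ^ 3"
      using n by (simp add: c_def \<rho>_def field_simps power2_eq_square power3_eq_cube)
    moreover have "gamma_rel A T = T * (1 / trace (?P T))"
      using small_horizon.gamma_rel_eq[OF horizon[OF elim]] by simp
    ultimately show ?case by (simp only: right_diff_distrib)
  qed
  ultimately have "(\<lambda>T. gamma_rel A T - (T / n + trace A / n ^ 2 * T ^ 2
              + ((trace A) ^ 2 / n ^ 3 - trace R / (12 * n ^ 2)) * T ^ 3)) \<in> O[at_right 0](\<lambda>t. t * t ^ 3)"
    by (rule iffD1[OF landau_o.big.in_cong, rotated])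
  then have gamma: "(\<lambda>T. gamma_rel A T - (T / n + trace A / n ^ 2 * T ^ 2
              + ((trace A) ^ 2 / n ^ 3 - trace R / (12 * n ^ 2)) * T ^ 3)) \<in> O[at_right 0](\<lambda>t. t ^ 4)"
    by (simp add: power_numeral_reduce)

  define Y where "Y T = (1 / n) *\<^sub>R
                 (mat 1 + T *\<^sub>R (c *\<^sub>R mat 1 - S)
                  + T ^ 2 *\<^sub>R ((c ^ 2 - trace R / (12 * n)) *\<^sub>R mat 1
                               - c *\<^sub>R S + (1 / 12) *\<^sub>R R))" for T
  have XY: "(\<lambda>T. (X T - Y T) $ i $ j) \<in> O[at_right 0](\<lambda>T. T ^ 3)" for i j
  proof -
    let ?I = "(mat 1 :: real^'n^'n) $ i $ j"
    have "(\<lambda>t. ?P t $ i $ j / trace (?P t) - (?I / n + (c * ?I - S $ i $ j) / n * t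
        + ((c ^ 2 - \<rho>) * ?I - c * S $ i $ j + R $ i $ j / 12) / n * t ^ 2)) \<in> O[at_right 0](\<lambda>t. t ^ 3)"
      by (rule ratio_expansion_at_right[OF entry tr])
        (use n in \<open>simp_all add: field_simps power2_eq_square\<close>)
    moreover have "(X t - Y t) $ i $ j = ?P t $ i $ j / trace (?P t) - (?I / n + (c * ?I - S $ i $ j) / n * t
        + ((c ^ 2 - \<rho>) * ?I - c * S $ i $ j + R $ i $ j / 12) / n * t ^ 2)" for t
      using n by (simp add: X_def Y_def \<rho>_def field_simps)
    ultimately show ?thesis by simp
  qed
  \<comment> \<open>The norm is at most the sum of the absolute values of the finitely many entries,
    so the entrywise estimates suffice.\<close>
  have "(\<lambda>T. \<Sum>i\<in>UNIV. \<Sum>j\<in>UNIV. \<bar>(X T - Y T) $ i $ j\<bar>) \<in> O[at_right 0](\<lambda>T. T ^ 3)"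
    by (intro big_sum_in_bigo) (use XY in simp)
  then have expansion: "(\<lambda>T. norm (X T - Y T)) \<in> O[at_right 0](\<lambda>T. T ^ 3)"
  proof (rule landau_o.big.trans[rotated], intro bigoI[where c = 1] always_eventually allI)
    fix T
    show "norm (norm (X T - Y T)) \<le> 1 * norm (\<Sum>i\<in>UNIV. \<Sum>j\<in>UNIV. \<bar>(X T - Y T) $ i $ j\<bar>)"
      using norm_matrix_le_sum[of "X T - Y T"] by (simp add: sum_nonneg)
  qed

  obtain r where r: "0 < r" "\<And>s. 0 < s \<Longrightarrow> s \<le> r \<Longrightarrow> real_analytic_on X {-s<..<s}"
    using real_analytic_normalized_preimage[OF K] unfolding X_def[abs_def] by blast
  have X: "X T = small_horizon.X_opt A T" if "T \<in> {0<..<\<delta>}" for T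
    by (simp add: X_def small_horizon.X_opt_def[OF horizon[OF that]])
  have "relaxed_maximizer A T Z \<longleftrightarrow> Z = X T" if "T \<in> {0<..<\<delta>}" for T Z
    using small_horizon.relaxed_maximizer_iff[OF horizon[OF that]] X[OF that] by simp
  then have "\<exists>T0>0. \<exists>X :: real \<Rightarrow> real^'n^'n.
          (\<forall>T\<in>{0<..<T0}. relaxed_maximizer A T (X T)
              \<and> (\<forall>Y. relaxed_maximizer A T Y \<longrightarrow> Y = X T))
        \<and> real_analytic_on X {-T0<..<T0}
        \<and> (\<lambda>T. norm (X T - Y T)) \<in> O[at_right 0](\<lambda>T. T ^ 3)"
    using expansion r \<delta> by (intro exI[of _ "min r \<delta>"] conjI exI[of _ X]) auto
  moreover have "\<exists>T0>0. \<forall>T\<in>{0<..<T0}. recovery_rank A T = CARD('n)"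
    using \<delta> small_horizon.recovery_rank_eq[OF horizon] by blast
  ultimately show ?thesis
    using gamma unfolding Y_def by blast
qed

end
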